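(* Let $r,s \in \mathbb{Z}$, $N,D \in \mathbb{N}$ with $(D,N)=1$, and let $\psi$ and $\chi$ be Dirichlet characters modulo $N$ and $D$, respectively. Let $F\in\mathcal{M}^!_{r,s}(\Gamma_0(N), \psi)$ have an expansion of the form $$F(z) = \sum_{|j| \le N_0}y^j\left ( \sum_{m, n \ge -N_0'} a_{m, n}^{(j)} \, e^{2\pi i m z}e^{-2\pi i n\overline{z}}\right)$$ with $N_0,N_0'\in\mathbb{N}$ and coefficients such that $$\sum_{m,n>0}|a_{m,n}^{(j)}|e^{-(n+m)c}$$ converges for all $c>0$ and $|j|\leq N_0$. Suppose that $G := F||_{r,s} W_N$ has an expansion of the same form with coefficients satisfying a condition of the same form. Define $$\widetilde{\mathcal{F}}_{F,G} := \bigcap_{\chi'\bmod D}\left\{\varphi\in\widetilde{\mathcal{F}}_{F_{\chi'}}:\varphi|_{2-r-s} W_N\in\widetilde{\mathcal{F}}_{G_{\overline{\chi'}}}\right\},$$ the intersection being over all Dirichlet characters $\chi'$ modulo $D$. Then $\widetilde{\mathcal{F}}_{F,G}$ is non-empty and, for every $\varphi \in \widetilde{\mathcal{F}}_{F,G}$ and $u\in\mathbb{R}$, $$L_{F_\chi}(\varphi ; u) = \frac{(i-u)^r(-i-u)^s\chi(-N)\psi(D)}{(u^2+1)^{(r+s)/2} N^{\frac{r+s-2}{2}}} L_{G_{\bar\chi}}(\varphi|_{2-r-s} W_N; -u).$$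
   Context: Notation: $z=x+iy\in\mathbb{H}$, $q=e^{2\pi iz}$, $\mathbb{R}_+=(0,\infty)$; $q^{m/M}=e^{2\pi imz/M}$ and $\bar q^{n/M}=e^{-2\pi in\bar z/M}$. For $\gamma=\begin{pmatrix}a&b\\c&d\end{pmatrix}\in GL^+(2,\mathbb{R})$ (positive determinant), $j(\gamma,z)=cz+d$ and for $f:\mathbb{H}\to\mathbb{C}$, $$(f||_{r,s}\gamma)(z)=\det(\gamma)^{\frac{r+s}{2}}j(\gamma,z)^{-r}j(\gamma,\bar z)^{-s}f(\gamma z).$$ $W_N=\begin{pmatrix}0&-N^{-1/2}\\N^{1/2}&0\end{pmatrix}$; for $\varphi:\mathbb{R}_+\to\mathbb{C}$ and $a\in\mathbb{Z}$, $(\varphi|_aW_N)(x)=(Nx)^{-a}\varphi(1/(Nx))$. $\mathcal{M}^!_{r,s}(\Gamma_0(N),\psi)$ is the space of real-analytic $F:\mathbb{H}\to\mathbb{C}$ such that (i) $F(\gamma z)=\psi(d)j(\gamma,z)^rj(\gamma,\bar z)^sF(z)$ for all $\gamma=\begin{pmatrix}a&b\\c&d\end{pmatrix}\in\Gamma_0(N)$ and $z\in\mathbb{H}$; (ii) $F(z)=\sum_{|j|\le N_0}y^j\big(\sum_{m,n\ge-N_0'}a_{m,n}^{(j)}q^m\bar q^n\big)$ for some $N_0,N_0'\in\mathbb{N}$, $a_{m,n}^{(j)}\in\mathbb{C}$; (iii) for all $\gamma\in SL_2(\mathbb{Z})$ there is $C>0$ with $(F||_{r,s}\gamma)(x+iy)=O(e^{Cy})$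 as $y\to\infty$, uniformly in $x$. (It is always assumed that $\psi(-1)=(-1)^{r+s}$.) Twist: for $H$ with an expansion as in (ii) and a Dirichlet character $\chi$ modulo $D$, $$H_\chi(z)=D^{(r+s)/2}\sum_{\mu\bmod D}\overline{\chi(\mu)}\left(H\Big|\Big|_{r,s}\begin{pmatrix}D^{-1/2}&\mu D^{-1/2}\\0&D^{1/2}\end{pmatrix}\right)(z)=\sum_{\mu\bmod D}\overline{\chi(\mu)}\,H\!\left(\frac{z+\mu}{D}\right);$$ substituting the expansion of $H$ gives an expansion of $H_\chi$ in the terms $y^jq^{m/D}\bar q^{n/D}$, used below with $M=D$. Laplace transform: $(\mathcal{L}\varphi)(s)=\int_0^\infty e^{-st}\varphi(t)\,dt$; $\varphi_{j+1}(y)=y^j\varphi(y)$. For $H(z)=\sum_{|j|\le N_0}y^j\big(\sum_{m,n\ge-N_0'}a_{m,n}^{(j)}q^{m/M}\bar q^{n/M}\big)$ with $M\in\mathbb{Z}_{>0}$, $\widetilde{\mathcal{F}}_H$ is the space of piecewise continuous functions $\varphi:\mathbb{R}\to\mathbb{C}$ (only the values on $\mathbb{R}_+$ enter) such that for all $u\in\mathbb{R}$ and $|j|\le N_0$ $$\sum_{m,n\ge-N_0'}|a_{m,n}^{(j)}|\,\mathcal{L}|\varphi_{j+1}|\left(\frac{2\pi(n+m)}{M\sqrt{u^2+1}}\right)<\infty,$$ and for $\varphi\in\widetilde{\mathcal{F}}_H$, $u\in\mathbb{R}$, $$L_H(\varphi;u)=\sum_{|j|\le N_0}\frac{1}{\sqrt{u^2+1}^{\,j+1}}\sum_{m,n\ge-N_0'}a_{m,n}^{(j)}\,\mathcal{L}\varphi_{j+1}\left(\frac{2\pi(n+m+iu(n-m))}{M\sqrt{u^2+1}}\right).$$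 *)

theory Defs
  imports "HOL-Analysis.Analysis"
begin

definition dirichlet_character :: "nat \<Rightarrow> (int \<Rightarrow> complex) \<Rightarrow> bool" where
  "dirichlet_character n chi \<longleftrightarrow>
     chi 1 = 1 \<and>
     (\<forall>a b. chi (a * b) = chi a * chi b) \<and>
     (\<forall>a. chi (a + int n) = chi a) \<and>
     (\<forall>a. chi a = 0 \<longleftrightarrow> \<not> coprime a (int n))"

definition cnj_char :: "(int \<Rightarrow> complex) \<Rightarrow> int \<Rightarrow> complex" where
  "cnj_char chi = (\<lambda>a. cnj (chi a))"

definition upper_half_plane :: "complex set" where
  "upper_half_plane = {z. Im z > 0}"

definition mat2 :: "'a \<Rightarrow> 'a \<Rightarrow> 'a \<Rightarrow> 'a \<Rightarrow> 'a::zero ^ 2 ^ 2" where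
  "mat2 a b c d = vector [vector [a, b], vector [c, d]]"

definition real_mat :: "int ^ 2 ^ 2 \<Rightarrow> real ^ 2 ^ 2" where
  "real_mat \<gamma> = (\<chi> i j. real_of_int (\<gamma> $ i $ j))"

definition SL2Z :: "(int ^ 2 ^ 2) set" where
  "SL2Z = {\<gamma>. det \<gamma> = 1}"

definition Gamma0 :: "nat \<Rightarrow> (int ^ 2 ^ 2) set" where
  "Gamma0 N = {\<gamma> \<in> SL2Z. int N dvd \<gamma> $ 2 $ 1}"

definition moebius :: "real ^ 2 ^ 2 \<Rightarrow> complex \<Rightarrow> complex" where
  "moebius \<gamma> z = (of_real (\<gamma> $ 1 $ 1) * z + of_real (\<gamma> $ 1 $ 2)) /
                 (of_real (\<gamma> $ 2 $ 1) * z + of_real (\<gamma> $ 2 $ 2))"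

definition jfactor :: "real ^ 2 ^ 2 \<Rightarrow> complex \<Rightarrow> complex" where
  "jfactor \<gamma> z = of_real (\<gamma> $ 2 $ 1) * z + of_real (\<gamma> $ 2 $ 2)"

definition slash :: "int \<Rightarrow> int \<Rightarrow> (complex \<Rightarrow> complex) \<Rightarrow> real ^ 2 ^ 2 \<Rightarrow> complex \<Rightarrow> complex" where
  "slash r s f \<gamma> z =
     of_real (det \<gamma> powr (real_of_int (r + s) / 2)) *
     jfactor \<gamma> z powi (- r) * jfactor \<gamma> (cnj z) powi (- s) * f (moebius \<gamma> z)"

definition fricke :: "nat \<Rightarrow> real ^ 2 ^ 2" where
  "fricke N = mat2 0 (- 1 / sqrt (real N)) (sqrt (real N)) 0"

text \<open>The action of the Fricke matrix on functions on the positive half-line; values at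
  \<open>x \<le> 0\<close> are junk and are never used.\<close>

definition slash_pos :: "int \<Rightarrow> nat \<Rightarrow> (real \<Rightarrow> complex) \<Rightarrow> real \<Rightarrow> complex" where
  "slash_pos a N \<phi> x = of_real ((real N * x) powi (- a)) * \<phi> (1 / (real N * x))"

text \<open>An \<open>expansion\<close> with components \<open>N\<^sub>0\<close>, \<open>N\<^sub>0'\<close> and \<open>a\<close> stands for the formal series
  \<open>\<Sum>\<^bsub>|j| \<le> N\<^sub>0\<^esub> y\<^sup>j (\<Sum>\<^bsub>m,n \<ge> -N\<^sub>0'\<^esub> a j m n q\<^bsup>m/M\<^esup> qbar\<^bsup>n/M\<^esup>)\<close>; the
  denominator \<open>M\<close> is a separate argument below. Only the values of \<open>a\<close> at indices in this range
  are ever used.\<close>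

record expansion =
  y_bound :: nat
  q_bound :: nat
  coeff :: "int \<Rightarrow> int \<Rightarrow> int \<Rightarrow> complex"

definition y_range :: "expansion \<Rightarrow> int set" where
  "y_range A = {- int (y_bound A)..int (y_bound A)}"

definition q_range :: "expansion \<Rightarrow> (int \<times> int) set" where
  "q_range A = {- int (q_bound A)..} \<times> {- int (q_bound A)..}"

definition q_term :: "nat \<Rightarrow> int \<Rightarrow> int \<Rightarrow> complex \<Rightarrow> complex" where
  "q_term M m n z =
     exp (2 * pi * \<i> * of_int m * z / of_nat M) * exp (- 2 * pi * \<i> * of_int n * cnj z / of_nat M)"

text \<open>The double series are unordered sums, that is, they converge absolutely.\<close>

definition has_expansion :: "(complex \<Rightarrow> complex) \<Rightarrow> nat \<Rightarrow> expansion \<Rightarrow> bool" where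
  "has_expansion H M A \<longleftrightarrow>
     (\<forall>z\<in>upper_half_plane.
        (\<forall>j\<in>y_range A. (\<lambda>(m, n). coeff A j m n * q_term M m n z) summable_on q_range A) \<and>
        H z = (\<Sum>j\<in>y_range A. of_real (Im z) powi j *
                 (\<Sum>\<^sub>\<infinity>(m, n)\<in>q_range A. coeff A j m n * q_term M m n z)))"

definition coeff_growth :: "expansion \<Rightarrow> bool" where
  "coeff_growth A \<longleftrightarrow>
     (\<forall>c>0. \<forall>j\<in>y_range A.
        (\<lambda>(m, n). cmod (coeff A j m n) * exp (- (real_of_int (n + m) * c)))
          summable_on ({0<..} \<times> {0<..}))"

text \<open>Real-analyticity in the two real variables \<open>x = Re z\<close> and \<open>y = Im z\<close>.\<close>

definition real_analytic_on :: "(complex \<Rightarrow> complex) \<Rightarrow> complex set \<Rightarrow> bool" where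
  "real_analytic_on f S \<longleftrightarrow>
     (\<forall>w\<in>S. \<exists>\<epsilon>>0. \<exists>c :: nat \<Rightarrow> nat \<Rightarrow> complex. \<forall>z\<in>ball w \<epsilon>.
        ((\<lambda>(k, l). c k l * of_real (Re z - Re w) ^ k * of_real (Im z - Im w) ^ l) has_sum f z) UNIV)"

definition weak_forms :: "int \<Rightarrow> int \<Rightarrow> nat \<Rightarrow> (int \<Rightarrow> complex) \<Rightarrow> (complex \<Rightarrow> complex) set" where
  "weak_forms r s N psi = {F.
     real_analytic_on F upper_half_plane \<and>
     (\<forall>\<gamma>\<in>Gamma0 N. \<forall>z\<in>upper_half_plane.
        F (moebius (real_mat \<gamma>) z) =
          psi (\<gamma> $ 2 $ 2) * jfactor (real_mat \<gamma>) z powi r * jfactor (real_mat \<gamma>) (cnj z) powi s * F z) \<and>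
     (\<exists>A. has_expansion F 1 A) \<and>
     (\<forall>\<gamma>\<in>SL2Z. \<exists>C>0. \<exists>K. \<forall>\<^sub>F y in at_top. \<forall>x.
        cmod (slash r s F (real_mat \<gamma>) (Complex x y)) \<le> K * exp (C * y))}"

definition twist :: "int \<Rightarrow> int \<Rightarrow> nat \<Rightarrow> (int \<Rightarrow> complex) \<Rightarrow> (complex \<Rightarrow> complex) \<Rightarrow> complex \<Rightarrow> complex" where
  "twist r s D chi H z =
     of_real (real D powr (real_of_int (r + s) / 2)) *
     (\<Sum>\<mu>\<in>{0..<int D}. cnj (chi \<mu>) *
        slash r s H (mat2 (1 / sqrt D) (of_int \<mu> / sqrt D) 0 (sqrt D)) z)"

text \<open>The expansion of a twist: substituting \<open>(z + \<mu>) / D\<close> into an expansion with \<open>M = 1\<close> turns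
  \<open>y\<^sup>j\<close> into \<open>y\<^sup>j / D\<^sup>j\<close> and multiplies the term of index \<open>m, n\<close> by \<open>exp (2 \<pi> \<i> (m - n) \<mu> / D)\<close>.
  That this represents the function \<^const>\<open>twist\<close>, with \<open>M = D\<close>, is lemma
  \<open>has_expansion_twist\<close>.\<close>

definition twist_expansion :: "nat \<Rightarrow> (int \<Rightarrow> complex) \<Rightarrow> expansion \<Rightarrow> expansion" where
  "twist_expansion D chi A = A \<lparr> coeff := (\<lambda>j m n.
     of_nat D powi (- j) *
     (\<Sum>\<mu>\<in>{0..<int D}. cnj (chi \<mu>) * exp (2 * pi * \<i> * of_int ((m - n) * \<mu>) / of_nat D)) *
     coeff A j m n) \<rparr>"

lemma twist_eq:
  assumes "D > 0"
  shows "twist r s D chi H z = (\<Sum>\<mu>\<in>{0..<int D}. cnj (chi \<mu>) * H ((z + of_int \<mu>) / of_nat D))"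
proof -
  define d where "d = sqrt (real D)"
  have d: "d > 0" "d * d = real D" using assms by (auto simp: d_def)
  define p where "p = real D powr (real_of_int (r + s) / 2)"
  have "p = (d powr 2) powr (real_of_int (r + s) / 2)"
    using d by (simp add: p_def powr_numeral power2_eq_square)
  also have "\<dots> = d powr (real_of_int (r + s))" unfolding powr_powr by (rule arg_cong[where f = "\<lambda>t. d powr t"]) (simp only: times_divide_eq_right nonzero_mult_div_cancel_left zero_neq_numeral not_False_eq_True)
  also have "\<dots> = d powi (r + s)" using d by (intro powr_real_of_int') auto
  finally have p: "p = d powi (r + s)" .
  have *: "of_real p * slash r s H (mat2 (1 / d) (of_int \<mu> / d) 0 d) z = H ((z + of_int \<mu>) / of_nat D)"
    for \<mu> :: int
  proof -
    have "moebius (mat2 (1 / d) (of_int \<mu> / d) 0 d) z = (z + of_int \<mu>) / (of_real d * of_real d)"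
      using d by (simp add: moebius_def mat2_def field_simps)
    also have "(of_real d * of_real d :: complex) = of_nat D"
      using d by (metis of_real_mult of_real_of_nat_eq)
    finally have m: "moebius (mat2 (1 / d) (of_int \<mu> / d) 0 d) z = (z + of_int \<mu>) / of_nat D" .
    have "complex_of_real p * (of_real d powi (- r) * of_real d powi (- s)) = 1"
      using d by (simp add: p power_int_add power_int_minus field_simps)
    moreover have "det (mat2 (1 / d) (of_int \<mu> / d) 0 d) = 1"
      using d by (simp add: det_2 mat2_def)
    ultimately show ?thesis
      by (simp add: slash_def m jfactor_def, simp add: mat2_def mult.assoc[symmetric])
  qed
  have "twist r s D chi H z =
    (\<Sum>\<mu>\<in>{0..<int D}. cnj (chi \<mu>) * (of_real p * slash r s H (mat2 (1 / d) (of_int \<mu> / d) 0 d) z))"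
    by (simp add: twist_def p_def d_def sum_distrib_left mult_ac)
  then show ?thesis by (simp only: *)
qed

lemma has_sum_sum_finite:
  fixes f :: "'a \<Rightarrow> 'b \<Rightarrow> complex"
  assumes "finite I" and "\<And>i. i \<in> I \<Longrightarrow> (f i has_sum S i) X"
  shows "((\<lambda>x. \<Sum>i\<in>I. f i x) has_sum (\<Sum>i\<in>I. S i)) X"
  using assms by (induction I) (auto intro!: has_sum_add has_sum_0)

lemma has_expansion_twist:
  assumes D: "D > 0" and H: "has_expansion H 1 A"
  shows "has_expansion (twist r s D chi H) D (twist_expansion D chi A)"
  unfolding has_expansion_def
proof
  fix z assume z: "z \<in> upper_half_plane"
  define w where "w = (\<lambda>\<mu>::int. (z + of_int \<mu>) / of_nat D)"
  define B where "B = twist_expansion D chi A"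
  have R: "y_range B = y_range A" "q_range B = q_range A"
    by (simp_all add: B_def twist_expansion_def y_range_def q_range_def)
  have w: "w \<mu> \<in> upper_half_plane" for \<mu>
    using z D by (simp add: w_def upper_half_plane_def Im_divide_of_nat)
  have Im_w: "Im (w \<mu>) = Im z / real D" for \<mu> by (simp add: w_def Im_divide_of_nat)
  define S where "S = (\<lambda>j \<mu>. \<Sum>\<^sub>\<infinity>(m, n)\<in>q_range A. coeff A j m n * q_term 1 m n (w \<mu>))"
  have S: "((\<lambda>(m, n). coeff A j m n * q_term 1 m n (w \<mu>)) has_sum S j \<mu>) (q_range A)"
    if "j \<in> y_range A" for j \<mu>
    unfolding S_def using H w that by (auto simp: has_expansion_def intro!: has_sum_infsum)
  have q: "q_term 1 m n (w \<mu>) = exp (2 * pi * \<i> * of_int ((m - n) * \<mu>) / of_nat D) * q_term D m n z"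
    for m n \<mu>
    unfolding q_term_def w_def exp_add[symmetric] using D
    by (intro arg_cong[where f = exp]) (simp add: field_simps)
  have sums: "((\<lambda>(m, n). coeff B j m n * q_term D m n z) has_sum
      (of_nat D powi (- j) * (\<Sum>\<mu>\<in>{0..<int D}. cnj (chi \<mu>) * S j \<mu>))) (q_range A)"
    if j: "j \<in> y_range A" for j
  proof -
    have "((\<lambda>x. of_nat D powi (- j) * (\<Sum>\<mu>\<in>{0..<int D}. cnj (chi \<mu>) *
            (case x of (m, n) \<Rightarrow> coeff A j m n * q_term 1 m n (w \<mu>)))) has_sum
          (of_nat D powi (- j) * (\<Sum>\<mu>\<in>{0..<int D}. cnj (chi \<mu>) * S j \<mu>))) (q_range A)"
      by (intro has_sum_cmult_right has_sum_sum_finite S j) simp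
    then show ?thesis
      by (rule has_sum_cong[THEN iffD1, rotated])
        (auto simp: B_def twist_expansion_def q[unfolded One_nat_def] sum_distrib_left sum_distrib_right mult_ac
          simp del: of_int_mult of_int_diff)
  qed
  have "twist r s D chi H z = (\<Sum>\<mu>\<in>{0..<int D}. cnj (chi \<mu>) * H (w \<mu>))"
    using D by (simp add: twist_eq w_def)
  also have "\<dots> = (\<Sum>\<mu>\<in>{0..<int D}. cnj (chi \<mu>) *
      (\<Sum>j\<in>y_range A. of_real (Im z / real D) powi j * S j \<mu>))"
    using H w by (simp add: has_expansion_def S_def Im_w)
  also have "\<dots> = (\<Sum>j\<in>y_range A. of_real (Im z / real D) powi j *
      (\<Sum>\<mu>\<in>{0..<int D}. cnj (chi \<mu>) * S j \<mu>))"
    unfolding sum_distrib_left by (subst sum.swap) (simp add: mult_ac)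
  also have "\<dots> = (\<Sum>j\<in>y_range A. of_real (Im z) powi j *
      (\<Sum>\<^sub>\<infinity>(m, n)\<in>q_range A. coeff B j m n * q_term D m n z))"
    using sums[THEN infsumI] D
    by (intro sum.cong) (simp_all add: power_int_divide_distrib power_int_minus field_simps)
  finally show "(\<forall>j\<in>y_range (twist_expansion D chi A).
        (\<lambda>(m, n). coeff (twist_expansion D chi A) j m n * q_term D m n z)
          summable_on q_range (twist_expansion D chi A)) \<and>
      twist r s D chi H z = (\<Sum>j\<in>y_range (twist_expansion D chi A). of_real (Im z) powi j *
        (\<Sum>\<^sub>\<infinity>(m, n)\<in>q_range (twist_expansion D chi A).
           coeff (twist_expansion D chi A) j m n * q_term D m n z))"
    using sums unfolding B_def[symmetric] R by (auto dest: has_sum_imp_summable)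
qed

definition laplace :: "(real \<Rightarrow> complex) \<Rightarrow> complex \<Rightarrow> complex" where
  "laplace \<phi> w = (LBINT t:{0<..}. exp (- w * of_real t) * \<phi> t)"

text \<open>The Laplace transform of \<open>|\<phi>|\<close> at a real point, with value \<open>\<infinity>\<close> in case of divergence.\<close>

definition laplace_abs :: "(real \<Rightarrow> complex) \<Rightarrow> real \<Rightarrow> ennreal" where
  "laplace_abs \<phi> w = (\<integral>\<^sup>+t\<in>{0<..}. ennreal (exp (- w * t) * cmod (\<phi> t)) \<partial>lborel)"

text \<open>This is the function written \<open>\<phi>\<close> with index \<open>j + 1\<close>.\<close>

definition mult_pow :: "int \<Rightarrow> (real \<Rightarrow> complex) \<Rightarrow> real \<Rightarrow> complex" where
  "mult_pow j \<phi> y = of_real (y powi j) * \<phi> y"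

text \<open>Piecewise continuity is required on the open half-line, i.e. on its compact subintervals:
  neither the values at \<open>x \<le> 0\<close> nor the behaviour at \<open>0\<close> are restricted, so that the condition
  is meaningful for \<^const>\<open>slash_pos\<close> too.\<close>

definition piecewise_continuous_pos :: "(real \<Rightarrow> complex) \<Rightarrow> bool" where
  "piecewise_continuous_pos \<phi> \<longleftrightarrow>
     (\<forall>a b. 0 < a \<longrightarrow> finite {x \<in> {a..b}. \<not> isCont \<phi> x}) \<and>
     (\<forall>x>0. (\<exists>l. (\<phi> \<longlongrightarrow> l) (at_left x)) \<and> (\<exists>l. (\<phi> \<longlongrightarrow> l) (at_right x)))"

text \<open>The sum is taken in \<open>[0, \<infinity>]\<close>, where \<open>0 \<cdot> \<infinity> = 0\<close>: vanishing coefficients impose no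
  condition.\<close>

definition test_space :: "nat \<Rightarrow> expansion \<Rightarrow> (real \<Rightarrow> complex) set" where
  "test_space M A = {\<phi>. piecewise_continuous_pos \<phi> \<and>
     (\<forall>u. \<forall>j\<in>y_range A.
        (\<Sum>\<^sub>\<infinity>(m, n)\<in>q_range A. ennreal (cmod (coeff A j m n)) *
           laplace_abs (mult_pow j \<phi>) (2 * pi * of_int (n + m) / (real M * sqrt (u\<^sup>2 + 1)))) < \<infinity>)}"

definition L_series :: "nat \<Rightarrow> expansion \<Rightarrow> (real \<Rightarrow> complex) \<Rightarrow> real \<Rightarrow> complex" where
  "L_series M A \<phi> u =
     (\<Sum>j\<in>y_range A. 1 / of_real (sqrt (u\<^sup>2 + 1) powi (j + 1)) *
        (\<Sum>\<^sub>\<infinity>(m, n)\<in>q_range A. coeff A j m n *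
           laplace (mult_pow j \<phi>)
             (2 * pi * (of_int (n + m) + \<i> * of_real u * of_int (n - m)) /
                (of_nat M * of_real (sqrt (u\<^sup>2 + 1))))))"

text \<open>The arguments \<open>A\<close> and \<open>B\<close> are the expansions of \<open>F\<close> and of its image under the Fricke
  matrix.\<close>

definition test_space_pair ::
  "int \<Rightarrow> int \<Rightarrow> nat \<Rightarrow> nat \<Rightarrow> expansion \<Rightarrow> expansion \<Rightarrow> (real \<Rightarrow> complex) set" where
  "test_space_pair r s N D A B =
     (\<Inter>chi\<in>{chi. dirichlet_character D chi}.
        {\<phi> \<in> test_space D (twist_expansion D chi A).
           slash_pos (2 - r - s) N \<phi> \<in> test_space D (twist_expansion D (cnj_char chi) B)})"

end

theory Submission
  imports Defs
begin

text \<open>Summing the Laplace transforms under the integral sign, the series \<open>L\<^sub>H(\<phi>; u)\<close> becomes the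
  integral of \<open>\<phi>(t) H(z)\<close> along the ray \<open>z = (u + \<i>) t / sqrt(u\<^sup>2 + 1)\<close>, divided by
  \<open>sqrt(u\<^sup>2 + 1)\<close>; the defining condition on test functions is exactly what Fubini needs. The map
  \<open>z \<mapsto> -1/(Nz)\<close> sends the ray of slope parameter \<open>u\<close> to that of \<open>-u\<close>, via \<open>t \<mapsto> 1/(Nt)\<close>. So the
  theorem is this change of variables combined with the classical transformation of the twist
  \<open>F\<^sub>\<chi>\<close> under the Fricke involution into a multiple of the twist of \<open>G\<close> by the conjugate
  character. The zero function shows that the test space is non-empty.\<close>

section \<open>Integration: termwise summation, measurability, inversion of the half-line\<close>

text \<open>Termwise integration of absolutely convergent series over the natural numbers carries
  over to a countable index set by enumerating it. The hypothesis \<open>fin\<close> is a sum in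
  [0, \<infinity>], the form in which the condition on test functions is given.\<close>

lemma integrable_infsum:
  fixes f :: "'i \<Rightarrow> 'a \<Rightarrow> 'b::{banach,second_countable_topology}"
  assumes cnt: "countable I"
    and meas: "\<And>i. i \<in> I \<Longrightarrow> f i \<in> borel_measurable M"
    and ptw: "\<And>x. x \<in> space M \<Longrightarrow> (\<lambda>i. norm (f i x)) summable_on I"
    and fin: "(\<Sum>\<^sub>\<infinity>i\<in>I. \<integral>\<^sup>+x. ennreal (norm (f i x)) \<partial>M) < \<infinity>"
  shows "integrable M (\<lambda>x. \<Sum>\<^sub>\<infinity>i\<in>I. f i x)"
    and "(\<integral>x. (\<Sum>\<^sub>\<infinity>i\<in>I. f i x) \<partial>M) = (\<Sum>\<^sub>\<infinity>i\<in>I. integral\<^sup>L M (f i))"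
proof -
  define J where "J = to_nat_on I ` I"
  \<comment> \<open>Extension by zero off the image of the enumeration treats finite and infinite
    \<open>I\<close> alike.\<close>
  define g where "g n = (if n \<in> J then f (from_nat_into I n) else (\<lambda>_. 0))" for n
  have bij: "bij_betw (from_nat_into I) J I"
    unfolding J_def using cnt
    by (intro bij_betw_byWitness[where f' = "to_nat_on I"]) auto
  have inI: "from_nat_into I n \<in> I" if "n \<in> J" for n
    using bij that by (auto simp: bij_betw_def)
  have reindex_infsum: "infsum h I = (\<Sum>\<^sub>\<infinity>n. if n \<in> J then h (from_nat_into I n) else 0)"
    for h :: "'i \<Rightarrow> 'c::{topological_comm_monoid_add,t2_space}"
    unfolding infsum_reindex_bij_betw[OF bij, symmetric] by (rule infsum_cong_neutral) auto
  have reindex_summable: "(\<lambda>n. if n \<in> J then h (from_nat_into I n) else 0) summable_on UNIV"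
    if "h summable_on I" for h :: "'i \<Rightarrow> real"
    using that unfolding summable_on_reindex_bij_betw[OF bij, symmetric]
    by (rule summable_on_cong_neutral[THEN iffD1, rotated -1]) auto
  have g_meas: "g n \<in> borel_measurable M" for n
    using meas inI by (auto simp: g_def)
  have g_ptw: "(\<lambda>n. norm (g n x)) summable_on UNIV" if "x \<in> space M" for x
    using reindex_summable[OF ptw[OF that]] by (rule summable_on_cong[THEN iffD1, rotated]) (auto simp: g_def)
  have g_sum: "(\<lambda>n. norm (g n x)) summable_on UNIV \<Longrightarrow> (\<Sum>n. g n x) = (\<Sum>\<^sub>\<infinity>i\<in>I. f i x)" for x
  proof -
    assume "(\<lambda>n. norm (g n x)) summable_on UNIV"
    then have "(\<lambda>n. g n x) summable_on UNIV" by (rule abs_summable_summable)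
    then have "(\<Sum>n. g n x) = (\<Sum>\<^sub>\<infinity>n. g n x)"
      by (intro sums_unique[symmetric] has_sum_imp_sums has_sum_infsum)
    also have "\<dots> = (\<Sum>\<^sub>\<infinity>i\<in>I. f i x)"
      unfolding reindex_infsum by (rule infsum_cong) (auto simp: g_def)
    finally show ?thesis .
  qed
  \<comment> \<open>Every family in [0, \<infinity>] is summable, so the series and the unordered
    sum agree.\<close>
  have "(\<Sum>n. \<integral>\<^sup>+x. ennreal (norm (g n x)) \<partial>M) = (\<Sum>\<^sub>\<infinity>n. \<integral>\<^sup>+x. ennreal (norm (g n x)) \<partial>M)"
    by (intro sums_unique[symmetric] has_sum_imp_sums has_sum_infsum nonneg_summable_on_complete) auto
  also have "\<dots> = (\<Sum>\<^sub>\<infinity>i\<in>I. \<integral>\<^sup>+x. ennreal (norm (f i x)) \<partial>M)"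
    unfolding reindex_infsum by (rule infsum_cong) (auto simp: g_def)
  finally have g_fin: "(\<Sum>n. \<integral>\<^sup>+x. ennreal (norm (g n x)) \<partial>M) < \<infinity>"
    using fin by simp
  have g_int: "integrable M (g n)" for n
  proof (rule integrableI_bounded[OF g_meas])
    have "(\<integral>\<^sup>+x. ennreal (norm (g n x)) \<partial>M) \<le> (\<Sum>n. \<integral>\<^sup>+x. ennreal (norm (g n x)) \<partial>M)"
      using sum_le_suminf[of "\<lambda>n. \<integral>\<^sup>+x. ennreal (norm (g n x)) \<partial>M" "{n}"] by auto
    then show "(\<integral>\<^sup>+x. ennreal (norm (g n x)) \<partial>M) < \<infinity>" using g_fin by (rule order.strict_trans1)
  qed
  have int_norm: "(\<integral>\<^sup>+x. ennreal (norm (g n x)) \<partial>M) = ennreal (\<integral>x. norm (g n x) \<partial>M)" for n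
    by (rule nn_integral_eq_integral) (auto intro: g_int)
  have sum_norm: "summable (\<lambda>n. \<integral>x. norm (g n x) \<partial>M)"
    by (rule summable_suminf_not_top) (use g_fin in \<open>auto simp: int_norm\<close>)
  have ae: "AE x in M. summable (\<lambda>n. norm (g n x))"
    using g_ptw by (auto intro: summable_on_imp_summable)
  note * = integrable_suminf[OF g_int ae sum_norm] integral_suminf[OF g_int ae sum_norm]
  show "integrable M (\<lambda>x. \<Sum>\<^sub>\<infinity>i\<in>I. f i x)"
    using *(1) by (rule Bochner_Integration.integrable_cong[THEN iffD1, rotated -1]) (auto simp: g_sum g_ptw)
  have "(\<integral>x. (\<Sum>\<^sub>\<infinity>i\<in>I. f i x) \<partial>M) = (\<integral>x. (\<Sum>n. g n x) \<partial>M)"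
    by (rule Bochner_Integration.integral_cong) (auto simp: g_sum g_ptw)
  also have "\<dots> = (\<Sum>n. integral\<^sup>L M (g n))" by (rule *(2))
  also have "\<dots> = (\<Sum>\<^sub>\<infinity>n. integral\<^sup>L M (g n))"
  proof (intro sums_unique[symmetric] has_sum_imp_sums has_sum_infsum norm_summable_imp_summable_on)
    show "summable (\<lambda>n. norm (integral\<^sup>L M (g n)))"
      by (rule summable_comparison_test'[OF sum_norm]) (simp add: integral_norm_bound)
  qed
  also have "\<dots> = (\<Sum>\<^sub>\<infinity>i\<in>I. integral\<^sup>L M (f i))"
    unfolding reindex_infsum by (rule infsum_cong) (auto simp: g_def)
  finally show "(\<integral>x. (\<Sum>\<^sub>\<infinity>i\<in>I. f i x) \<partial>M) = (\<Sum>\<^sub>\<infinity>i\<in>I. integral\<^sup>L M (f i))" .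
qed

text \<open>A function continuous off a countable set is Borel. The discontinuities on the open
  half-line are countable because the intervals [1/(n+1), n] exhaust it and each contains finitely
  many of them.\<close>

lemma piecewise_continuous_pos_measurable:
  assumes "piecewise_continuous_pos \<phi>"
  shows "(\<lambda>t. indicator {0<..} t *\<^sub>R \<phi> t) \<in> borel_measurable borel"
proof -
  \<comment> \<open>The point 0 is included because truncation to the half-line may create a jump
    there.\<close>
  define X where "X = insert 0 (\<Union>n::nat. {x \<in> {1 / real (Suc n)..real n}. \<not> isCont \<phi> x})"
  have "countable X"
    using assms unfolding X_def piecewise_continuous_pos_def
    by (intro countable_insert countable_UN[OF countableI_type] countable_finite) auto
  moreover have "continuous_on (- X) (\<lambda>t. indicator {0<..} t *\<^sub>R \<phi> t)"
  proof (intro continuous_at_imp_continuous_on ballI)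
    fix x assume x: "x \<in> - X"
    consider "x < 0" | "x > 0" using x by (force simp: X_def)
    then show "isCont (\<lambda>t. indicator {0<..} t *\<^sub>R \<phi> t) x"
    proof cases
      case 1
      then have "\<forall>\<^sub>F t in nhds x. indicator {0<..} t *\<^sub>R \<phi> t = 0"
        by (auto intro!: eventually_nhds_in_open[of "{..<0}" x, THEN eventually_mono])
      from isCont_cong[OF this] show ?thesis by simp
    next
      case 2
      obtain k where k: "1 / real (Suc k) < x"
        using 2 by (metis nat_approx_posE)
      obtain l where l: "x < real l" using reals_Archimedean2 by blast
      have "1 / real (Suc (max k l)) \<le> 1 / real (Suc k)" by (simp add: frac_le)
      then have "x \<in> {1 / real (Suc (max k l))..real (max k l)}" using k l by auto
      then have "isCont \<phi> x" using x by (auto simp: X_def)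
      have "\<forall>\<^sub>F t in nhds x. indicator {0<..} t *\<^sub>R \<phi> t = \<phi> t"
        using 2 by (auto intro!: eventually_nhds_in_open[of "{0<..}" x, THEN eventually_mono])
      from isCont_cong[OF this] show ?thesis using \<open>isCont \<phi> x\<close> by simp
    qed
  qed
  ultimately show ?thesis by (rule borel_measurable_continuous_countable_exceptions)
qed

text \<open>This is the substitution t -> 1/(c t), an involution of the half-line whose derivative
  has absolute value 1/(c t^2).\<close>

lemma set_integral_inversion:
  fixes f :: "real \<Rightarrow> complex" and c :: real
  assumes c: "c > 0" and f: "set_integrable lborel {0<..} f"
  shows "(LBINT t:{0<..}. f t) = (LBINT t:{0<..}. f (1 / (c * t)) / of_real (c * t\<^sup>2))"
proof -
  define g where "g t = 1 / (c * t)" for t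
  have deriv: "(g has_field_derivative - (1 / (c * t\<^sup>2))) (at t within {0<..})" if "t \<in> {0<..}" for t
    unfolding g_def using c that
    by (auto intro!: derivative_eq_intros simp: field_simps power2_eq_square)
  have inj: "inj_on g {0<..}"
    using c by (auto simp: inj_on_def g_def)
  have img: "g ` {0<..} = {0<..}"
  proof safe
    fix x :: real assume "x > 0"
    then show "x \<in> g ` {0<..}" using c by (intro image_eqI[of _ _ "1 / (c * x)"]) (auto simp: g_def)
  qed (use c in \<open>auto simp: g_def\<close>)
  \<comment> \<open>Substitution is first carried out for real-valued functions and then applied to
    real and imaginary parts.\<close>
  have cov: "set_integrable lborel {0<..} (\<lambda>t. h (g t) / (c * t\<^sup>2)) \<and>
      (LBINT t:{0<..}. h t) = (LBINT t:{0<..}. h (g t) / (c * t\<^sup>2))"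
    if h: "set_integrable lborel {0<..} h" for h :: "real \<Rightarrow> real"
  proof -
    have g_meas: "g \<in> borel_measurable borel" unfolding g_def by measurable
    have h_meas: "(\<lambda>t. indicator {0<..} t *\<^sub>R h t) \<in> borel_measurable borel"
      using h by (auto simp: set_integrable_def)
    \<comment> \<open>Only the truncation of \<open>h\<close> is known to be Borel. Since
      \<open>g\<close> preserves the half-line, composing this truncation with \<open>g\<close> and
      truncating again gives the right function. Borel measurability permits the return from
      Lebesgue measure, used by the substitution rule, to \<open>lborel\<close>.\<close>
    have "(\<lambda>t. indicator {0<..} t * ((indicator {0<..} (g t) *\<^sub>R h (g t)) / (c * t\<^sup>2))) \<in> borel_measurable borel"
      using measurable_compose[OF g_meas h_meas] by measurable
    also have "(\<lambda>t. indicator {0<..} t * ((indicator {0<..} (g t) *\<^sub>R h (g t)) / (c * t\<^sup>2))) =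
        (\<lambda>t. indicator {0<..} t *\<^sub>R (h (g t) / (c * t\<^sup>2)))"
      using c by (auto simp: indicator_def g_def)
    finally have hg_meas: "(\<lambda>t. indicator {0<..} t *\<^sub>R (h (g t) / (c * t\<^sup>2))) \<in> borel_measurable borel" .
    have "h absolutely_integrable_on {0<..}"
      using h h_meas by (simp add: set_integrable_def integrable_completion)
    moreover have "(\<lambda>t. \<bar>- (1 / (c * t\<^sup>2))\<bar> * h (g t)) = (\<lambda>t. h (g t) / (c * t\<^sup>2))"
      using c by (auto simp: fun_eq_iff abs_mult)
    ultimately have *: "(\<lambda>t. h (g t) / (c * t\<^sup>2)) absolutely_integrable_on {0<..} \<and>
        integral {0<..} (\<lambda>t. h (g t) / (c * t\<^sup>2)) = integral {0<..} h"
      using has_absolute_integral_change_of_variables_1'[OF _ deriv inj, of h "integral {0<..} h"]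
      by (simp add: img)
    then have "set_integrable lborel {0<..} (\<lambda>t. h (g t) / (c * t\<^sup>2))"
      using hg_meas by (simp add: set_integrable_def integrable_completion)
    then show ?thesis using * h by (simp add: set_borel_integral_eq_integral)
  qed
  define F where "F t = f (1 / (c * t)) / of_real (c * t\<^sup>2)" for t
  have F: "Re (F t) = Re (f (g t)) / (c * t\<^sup>2)" "Im (F t) = Im (f (g t)) / (c * t\<^sup>2)" for t
    by (simp_all add: F_def g_def Re_divide_of_real Im_divide_of_real del: of_real_mult of_real_power)
  have f': "integrable lborel (\<lambda>t. indicator {0<..} t *\<^sub>R f t)"
    using f by (simp add: set_integrable_def)
  have re: "set_integrable lborel {0<..} (\<lambda>t. Re (f t))" and im: "set_integrable lborel {0<..} (\<lambda>t. Im (f t))"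
    using integrable_Re[OF f'] integrable_Im[OF f'] by (auto simp: set_integrable_def)
  note Re = cov[OF re, folded F] and Im = cov[OF im, folded F]
  have "integrable lborel (\<lambda>t. complex_of_real (indicator {0<..} t *\<^sub>R Re (F t)) +
      \<i> * complex_of_real (indicator {0<..} t *\<^sub>R Im (F t)))"
    using Re Im
    by (intro Bochner_Integration.integrable_add integrable_mult_right integrable_of_real) (auto simp: set_integrable_def)
  also have "(\<lambda>t. complex_of_real (indicator {0<..} t *\<^sub>R Re (F t)) +
      \<i> * complex_of_real (indicator {0<..} t *\<^sub>R Im (F t))) = (\<lambda>t. indicator {0<..} t *\<^sub>R F t)"
    by (auto simp: complex_eq_iff)
  finally have F_int: "integrable lborel (\<lambda>t. indicator {0<..} t *\<^sub>R F t)" .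
  have "(LBINT t:{0<..}. f t) = (LBINT t:{0<..}. F t)"
    using Re Im integral_Re[OF f'] integral_Im[OF f'] integral_Re[OF F_int] integral_Im[OF F_int]
    unfolding set_lebesgue_integral_def
    by (intro complex_eqI) simp_all
  then show ?thesis by (simp add: F_def)
qed

section \<open>The L-series as an integral along a ray\<close>

text \<open>On the ray, Im z = t/R and each q-term is an exponential in t, so its integral against
  t^j \<phi>(t) is a Laplace transform. Membership in \<open>test_space\<close> supplies the
  hypothesis \<open>fin\<close> of \<open>integrable_infsum\<close>.\<close>

lemma L_series_eq_integral:
  fixes u :: real
  assumes M: "M > 0" and H: "has_expansion H M A" and \<phi>: "\<phi> \<in> test_space M A"
  defines "R \<equiv> sqrt (u\<^sup>2 + 1)"
  shows "set_integrable lborel {0<..} (\<lambda>t. \<phi> t * H ((of_real u + \<i>) * of_real (t / R)))"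
    and "L_series M A \<phi> u = (LBINT t:{0<..}. \<phi> t * H ((of_real u + \<i>) * of_real (t / R))) / of_real R"
proof -
  have R: "R > 0" unfolding R_def by (simp add: add_nonneg_pos)
  define I where "I = {0::real<..}"
  define z where "z t = (of_real u + \<i>) * of_real (t / R)" for t
  have z: "z t \<in> upper_half_plane" "Im (z t) = t / R" if "t \<in> I" for t
    using that R by (auto simp: z_def I_def upper_half_plane_def)
  define W where "W m n = 2 * pi * (of_int (n + m) + \<i> * of_real u * of_int (n - m)) / (of_nat M * of_real R)"
    for m n :: int
  define V where "V m n = 2 * pi * of_int (n + m) / (real M * R)" for m n :: int
  \<comment> \<open>With z = (u + i) t/R one has i (m z - n cnj z) = -((n + m) + i u (n - m)) t/R,
    which is where the argument of the Laplace transform comes from.\<close>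
  have q_term_z: "q_term M m n (z t) = exp (- W m n * of_real t)" for m n t
    unfolding q_term_def exp_add[symmetric] W_def z_def using M R
    by (intro arg_cong[where f = exp]) (simp add: field_simps)
  \<comment> \<open>Hence |exp(-W t)| = exp(-V t): absolute values of the terms integrate to
    \<open>laplace_abs\<close> at \<open>V\<close>, up to the coefficient.\<close>
  have Re_W: "Re (W m n) = V m n" for m n
  proof -
    have "W m n = of_real (V m n) + \<i> * of_real (2 * pi * u * of_int (n - m) / (real M * R))"
      by (simp add: W_def V_def add_divide_distrib ring_distribs mult_ac)
    then show ?thesis by simp
  qed
  \<comment> \<open>The cut-off is built into the terms so that they are summable at every real t,
    including t \<le> 0, where the expansion says nothing.\<close>
  define f where "f j p t = indicator I t *\<^sub>R (case p of (m, n) \<Rightarrow> coeff A j m n * (exp (- W m n * of_real t) * mult_pow j \<phi> t))"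
    for j p t
  have f_eq: "f j p t = indicator I t *\<^sub>R (of_real (t powi j) * \<phi> t) *
      (case p of (m, n) \<Rightarrow> coeff A j m n * q_term M m n (z t))" for j p t
    by (simp add: f_def q_term_z mult_pow_def split: prod.split)
  have \<phi>_meas: "(\<lambda>t. indicator I t *\<^sub>R \<phi> t) \<in> borel_measurable borel"
    using \<phi> unfolding I_def by (intro piecewise_continuous_pos_measurable) (auto simp: test_space_def)
  have powi_meas: "(\<lambda>t. complex_of_real (t powi j)) \<in> borel_measurable borel" for j
    unfolding power_int_def by measurable
  have f_meas: "f j p \<in> borel_measurable lborel" for j p
  proof -
    have "(\<lambda>t. (case p of (m, n) \<Rightarrow> coeff A j m n * exp (- W m n * of_real t)) *
        (of_real (t powi j) * (indicator I t *\<^sub>R \<phi> t))) \<in> borel_measurable borel"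
      by (intro borel_measurable_times powi_meas \<phi>_meas) (cases p, auto intro!: borel_measurable_continuous_onI continuous_intros)
    then have "(\<lambda>t. (case p of (m, n) \<Rightarrow> coeff A j m n * exp (- W m n * of_real t)) *
        (of_real (t powi j) * (indicator I t *\<^sub>R \<phi> t))) \<in> borel_measurable lborel" by simp
    then show ?thesis
      by (rule measurable_cong[THEN iffD1, rotated]) (auto simp: f_def mult_pow_def split: prod.split)
  qed
  have f_sum: "((\<lambda>p. f j p t) has_sum indicator I t *\<^sub>R (of_real (t powi j) * \<phi> t) *
      (\<Sum>\<^sub>\<infinity>(m, n)\<in>q_range A. coeff A j m n * q_term M m n (z t))) (q_range A)"
    if j: "j \<in> y_range A" for j t
  proof (cases "t \<in> I")
    case True
    then show ?thesis unfolding f_eq using H j z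
      by (intro has_sum_cmult_right has_sum_infsum) (auto simp: has_expansion_def)
  qed (simp add: f_eq)
  have f_norm: "(\<integral>\<^sup>+t. ennreal (norm (f j (m, n) t)) \<partial>lborel) =
      ennreal (cmod (coeff A j m n)) * laplace_abs (mult_pow j \<phi>) (V m n)" for j m n
  proof -
    have "(\<lambda>t. indicator I t *\<^sub>R mult_pow j \<phi> t) = (\<lambda>t. of_real (t powi j) * (indicator I t *\<^sub>R \<phi> t))"
      by (simp add: mult_pow_def)
    then have "(\<lambda>t. indicator I t *\<^sub>R mult_pow j \<phi> t) \<in> borel_measurable borel"
      by (simp only: borel_measurable_times powi_meas \<phi>_meas)
    note [measurable] = this
    have "(\<lambda>t. ennreal (exp (- V m n * t) * norm (indicator I t *\<^sub>R mult_pow j \<phi> t))) \<in> borel_measurable lborel"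
      by measurable
    also have "(\<lambda>t. ennreal (exp (- V m n * t) * norm (indicator I t *\<^sub>R mult_pow j \<phi> t))) =
        (\<lambda>t. ennreal (exp (- V m n * t) * cmod (mult_pow j \<phi> t)) * indicator I t)"
      by (auto simp: indicator_def)
    finally show ?thesis
      unfolding laplace_abs_def I_def[symmetric]
      by (subst nn_integral_cmult[symmetric])
        (auto intro!: nn_integral_cong simp: f_def norm_mult Re_W ennreal_mult' indicator_def mult_ac)
  qed
  have f_integral: "integral\<^sup>L lborel (f j (m, n)) = coeff A j m n * laplace (mult_pow j \<phi>) (W m n)" for j m n
  proof -
    have "f j (m, n) = (\<lambda>t. coeff A j m n * (indicator I t *\<^sub>R (exp (- W m n * of_real t) * mult_pow j \<phi> t)))"
      by (auto simp: f_def)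
    then show ?thesis
      by (simp only: integral_mult_right_zero laplace_def set_lebesgue_integral_def I_def)
  qed
  have fin: "(\<Sum>\<^sub>\<infinity>p\<in>q_range A. \<integral>\<^sup>+t. ennreal (norm (f j p t)) \<partial>lborel) < \<infinity>" if "j \<in> y_range A" for j
  proof -
    have "(\<Sum>\<^sub>\<infinity>p\<in>q_range A. \<integral>\<^sup>+t. ennreal (norm (f j p t)) \<partial>lborel) =
      (\<Sum>\<^sub>\<infinity>(m, n)\<in>q_range A. ennreal (cmod (coeff A j m n)) * laplace_abs (mult_pow j \<phi>) (V m n))"
      by (rule infsum_cong) (auto simp: f_norm)
    then show ?thesis using \<phi> that by (auto simp: test_space_def V_def R_def)
  qed
  \<comment> \<open>For complex families unordered summability is absolute, so the expansion itself
    gives the pointwise hypothesis of \<open>integrable_infsum\<close>.\<close>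
  have abs: "(\<lambda>p. norm (f j p t)) summable_on q_range A" if "j \<in> y_range A" for j t
    using has_sum_imp_summable[OF f_sum[OF that]] by (simp add: summable_on_iff_abs_summable_on_complex)
  have cnt: "countable (q_range A)" by (rule countableI_type)
  note int = integrable_infsum[OF cnt f_meas abs fin]
  \<comment> \<open>Division by R^j turns the factor t^j of \<open>mult_pow\<close> into (Im
    z)^j.\<close>
  define g where "g t = (\<Sum>j\<in>y_range A. (\<Sum>\<^sub>\<infinity>p\<in>q_range A. f j p t) / of_real (R powi j))" for t
  have g: "g t = indicator I t *\<^sub>R (\<phi> t * H (z t))" for t
  proof (cases "t \<in> I")
    case True
    have "g t = (\<Sum>j\<in>y_range A. (of_real (t powi j) * \<phi> t) *
        (\<Sum>\<^sub>\<infinity>(m, n)\<in>q_range A. coeff A j m n * q_term M m n (z t)) / of_real (R powi j))"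
      unfolding g_def using True infsumI[OF f_sum] by (intro sum.cong) auto
    also have "\<dots> = \<phi> t * H (z t)"
      using H z[OF True] unfolding has_expansion_def
      by (auto simp: sum_distrib_left power_int_divide_distrib field_simps intro!: sum.cong)
    finally show ?thesis using True by simp
  qed (simp add: g_def f_def)
  have "integrable lborel g"
    unfolding g_def by (intro Bochner_Integration.integrable_sum integrable_divide int(1))
  then show "set_integrable lborel {0<..} (\<lambda>t. \<phi> t * H ((of_real u + \<i>) * of_real (t / R)))"
    unfolding g set_integrable_def I_def z_def .
  have "integral\<^sup>L lborel g = (\<Sum>j\<in>y_range A. (\<Sum>\<^sub>\<infinity>p\<in>q_range A. integral\<^sup>L lborel (f j p)) / of_real (R powi j))"
    unfolding g_def using int
    by (subst Bochner_Integration.integral_sum) (auto intro!: sum.cong integrable_divide)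
  also have "\<dots> = (\<Sum>j\<in>y_range A. (\<Sum>\<^sub>\<infinity>(m, n)\<in>q_range A. coeff A j m n * laplace (mult_pow j \<phi>) (W m n)) / of_real (R powi j))"
    by (intro sum.cong refl arg_cong2[where f = "(/)"] infsum_cong) (auto simp: f_integral)
  \<comment> \<open>The exponent j + 1 in \<open>L_series\<close> combines R^j from Im z = t/R with
    the outer factor 1/R.\<close>
  also have "\<dots> / of_real R = L_series M A \<phi> u"
    unfolding L_series_def R_def[symmetric] W_def[symmetric] sum_divide_distrib using R
    by (intro sum.cong) (auto simp: power_int_add field_simps)
  finally have "L_series M A \<phi> u = integral\<^sup>L lborel g / of_real R" by simp
  then show "L_series M A \<phi> u = (LBINT t:{0<..}. \<phi> t * H ((of_real u + \<i>) * of_real (t / R))) / of_real R"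
    unfolding g set_lebesgue_integral_def I_def z_def .
qed

section \<open>Fricke involution, Dirichlet characters and twists\<close>

lemma slash_fricke:
  assumes "N > 0" "z \<noteq> 0"
  shows "slash r s F (fricke N) z =
    (of_real (sqrt N) * z) powi (- r) * (of_real (sqrt N) * cnj z) powi (- s) * F (- 1 / (of_nat N * z))"
proof -
  define d where "d = sqrt (real N)"
  have d: "d > 0" "of_real d * of_real d = (of_nat N :: complex)"
    using assms by (auto simp: d_def simp flip: of_real_mult)
  have "moebius (fricke N) z = - 1 / (of_real d * of_real d * z)"
    using d assms by (simp add: moebius_def fricke_def mat2_def field_simps d_def[symmetric])
  moreover have "det (fricke N) = 1"
    using d by (simp add: det_2 fricke_def mat2_def d_def[symmetric])
  ultimately show ?thesis
    by (simp add: slash_def d) (simp add: jfactor_def fricke_def mat2_def)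
qed

lemma Gamma0_transform:
  fixes k b c d :: int
  assumes "\<forall>\<gamma>\<in>Gamma0 N. \<forall>z\<in>upper_half_plane.
      F (moebius (real_mat \<gamma>) z) =
        psi (\<gamma> $ 2 $ 2) * jfactor (real_mat \<gamma>) z powi r * jfactor (real_mat \<gamma>) (cnj z) powi s * F z"
    and "k * d - b * c = 1" "int N dvd c" "z \<in> upper_half_plane"
  shows "F ((of_int k * z + of_int b) / (of_int c * z + of_int d)) =
    psi d * (of_int c * z + of_int d) powi r * (of_int c * cnj z + of_int d) powi s * F z"
proof -
  have "mat2 k b c d \<in> Gamma0 N"
    using assms(2,3) by (simp add: Gamma0_def SL2Z_def det_2 mat2_def)
  from assms(1)[rule_format, OF this assms(4)] show ?thesis
    by (simp add: moebius_def jfactor_def real_mat_def mat2_def)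
qed

lemma dirichlet_character_cong:
  assumes "dirichlet_character n chi" "a mod int n = b mod int n"
  shows "chi a = chi b"
proof -
  have *: "chi (a + int k * int n) = chi a" for a k
  proof (induction k)
    case (Suc k)
    have "chi (a + int (Suc k) * int n) = chi (a + int k * int n + int n)" by (simp add: algebra_simps)
    also have "\<dots> = chi a" using assms(1) Suc by (simp add: dirichlet_character_def)
    finally show ?case .
  qed simp
  have **: "chi (a + k * int n) = chi a" for a k
  proof (cases "k \<ge> 0")
    case True
    then show ?thesis using *[of a "nat k"] by simp
  next
    case False
    \<comment> \<open>A negative multiple is undone by adding -k periods to the shifted
      argument.\<close>
    then show ?thesis using *[of "a + k * int n" "nat (- k)"] by simp
  qed
  from assms(2) obtain k where "a - b = int n * k" by (metis dvdE mod_eq_dvd_iff)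
  then show ?thesis using **[of b k] by (simp add: algebra_simps)
qed

text \<open>Powers of a value are again values, and there are only finitely many of them, whereas a
  value outside the closed unit disc has unbounded powers.\<close>

lemma dirichlet_character_norm_le:
  assumes chi: "dirichlet_character n chi" and "n > 0"
  shows "cmod (chi a) \<le> 1"
proof (rule ccontr)
  assume "\<not> cmod (chi a) \<le> 1"
  define C where "C = Max ((\<lambda>b. cmod (chi b)) ` {0..<int n})"
  have C: "cmod (chi b) \<le> C" for b
  proof -
    have "chi b = chi (b mod int n)" using chi by (rule dirichlet_character_cong) simp
    then show ?thesis unfolding C_def using \<open>n > 0\<close> by (auto intro!: Max_ge)
  qed
  obtain k where "C < cmod (chi a) ^ k"
    using real_arch_pow \<open>\<not> cmod (chi a) \<le> 1\<close> by (metis not_le)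
  also have "chi a ^ k = chi (a ^ k)"
    using chi by (induction k) (auto simp: dirichlet_character_def)
  then have "cmod (chi a) ^ k = cmod (chi (a ^ k))" by (metis norm_power)
  finally show False using C[of "a ^ k"] by simp
qed

text \<open>The value at an inverse of \<open>a\<close> modulo \<open>n\<close> is the reciprocal of
  \<open>chi a\<close>, and neither exceeds 1 in absolute value.\<close>

lemma dirichlet_character_norm:
  assumes chi: "dirichlet_character n chi" and "n > 0" "coprime a (int n)"
  shows "cmod (chi a) = 1"
proof -
  obtain b v where "b * a + v * int n = 1"
    using bezout_int[of a "int n"] assms(3) by (metis coprime_iff_gcd_eq_1)
  then have "(a * b) mod int n = 1 mod int n"
    by (metis mod_mult_self2 mult.commute)
  then have "chi a * chi b = 1"
    using dirichlet_character_cong[OF chi] chi by (metis dirichlet_character_def)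
  then have "cmod (chi a) * cmod (chi b) = 1" by (metis norm_mult norm_one)
  moreover have "cmod (chi a) * cmod (chi b) \<le> cmod (chi a) * 1"
    using dirichlet_character_norm_le[OF chi] \<open>n > 0\<close> by (intro mult_left_mono) auto
  ultimately show ?thesis
    using dirichlet_character_norm_le[OF chi, of a] \<open>n > 0\<close> by linarith
qed

text \<open>The two twists are matched term by term: \<mu> on the left corresponds to l on the right
  when N l \<mu> is -1 modulo D. The lower right entry D of the matrix in \<Gamma>0(N) produces
  \<open>psi (int D)\<close>, and cnj (chi \<mu>) = chi(-N) chi(l) lets chi(-N) factor out.\<close>

lemma twist_fricke:
  assumes N: "N > 0" and D: "D > 0" and cop: "coprime D N" and chi: "dirichlet_character D chi"
    and F: "\<forall>\<gamma>\<in>Gamma0 N. \<forall>z\<in>upper_half_plane.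
      F (moebius (real_mat \<gamma>) z) =
        psi (\<gamma> $ 2 $ 2) * jfactor (real_mat \<gamma>) z powi r * jfactor (real_mat \<gamma>) (cnj z) powi s * F z"
    and z: "z \<in> upper_half_plane"
  shows "twist r s D chi F (- 1 / (of_nat N * z)) =
    chi (- int N) * psi (int D) * (of_real (sqrt N) * z) powi r * (of_real (sqrt N) * cnj z) powi s *
      twist r s D (cnj_char chi) (slash r s F (fricke N)) z"
proof -
  define G where "G = slash r s F (fricke N)"
  define K where "K = psi (int D) * (of_real (sqrt N) * z) powi r * (of_real (sqrt N) * cnj z) powi s"
  \<comment> \<open>Residues prime to D carry the whole sum and are the ones with an inverse. For D
    = 1 this set is {0}.\<close>
  define U where "U = {\<mu> \<in> {0..<int D}. coprime \<mu> (int D)}"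
  have mult: "chi (a * b) = chi a * chi b" and one: "chi 1 = 1"
    and zero: "\<not> coprime a (int D) \<Longrightarrow> chi a = 0" for a b
    using chi by (auto simp: dirichlet_character_def)
  have copN: "coprime (int N) (int D)" using cop by (simp add: coprime_commute)
  \<comment> \<open>If \<open>N l \<mu> + 1 = D k\<close>, the matrix with rows \<open>(k, \<mu>)\<close> and \<open>(N l, D)\<close> lies in \<open>\<Gamma>\<^sub>0(N)\<close> and sends the
    Fricke image \<open>v\<close> of \<open>(z + l) / D\<close> to the point on the left.\<close>
  have transform: "F ((- 1 / (of_nat N * z) + of_int \<mu>) / of_nat D) = K * G ((z + of_int l) / of_nat D)"
    if dvd: "int D dvd int N * l * \<mu> + 1" for \<mu> l :: int
  proof -
    from dvd obtain k where k: "int N * l * \<mu> + 1 = int D * k" by blast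
    have "complex_of_int (int N * l * \<mu> + 1) = complex_of_int (int D * k)" using k by simp
    then have k': "of_nat N * of_int l * of_int \<mu> + 1 = (of_nat D * of_int k :: complex)" by simp
    define y where "y = z + of_int l"
    have y: "Im y > 0" "Im (cnj y) < 0" using z by (auto simp: y_def upper_half_plane_def)
    have nz: "y \<noteq> 0" "cnj y \<noteq> 0" "z \<noteq> 0" "cnj z \<noteq> 0" using y z by (auto simp: upper_half_plane_def)
    define v where "v = - of_nat D / (of_nat N * y)"
    have v_eq: "v = - (of_real (real D / real N) / y)" using N by (simp add: v_def field_simps)
    have "Im v > 0" using y N D unfolding v_eq
      by (simp add: Im_divide_of_real Im_divide field_simps add_pos_nonneg)
    then have v: "v \<in> upper_half_plane" by (simp add: upper_half_plane_def)
    have j: "of_int (int N * l) * v + of_int (int D) = of_nat D * z / y"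
    proof -
      have "of_int (int N * l) * v + of_int (int D) = of_nat D * (y - of_int l) / y"
        using nz(1) N by (simp add: v_def field_simps)
      then show ?thesis by (simp add: y_def)
    qed
    have j': "of_int (int N * l) * cnj v + of_int (int D) = of_nat D * cnj z / cnj y"
      using arg_cong[OF j, of cnj] by simp
    \<comment> \<open>After multiplication by N y the constant terms are N l \<mu> - D k, which is
      -1 by the choice of k.\<close>
    have num: "of_int k * v + of_int \<mu> = (of_nat N * of_int \<mu> * z - 1) / (of_nat N * y)"
    proof -
      have "(of_int k * v + of_int \<mu>) * (of_nat N * y) = of_int \<mu> * (of_nat N * y) - of_nat D * of_int k"
        using nz N by (simp add: v_def field_simps)
      also have "\<dots> = of_nat N * of_int \<mu> * z - 1"
        unfolding k'[symmetric] y_def by (simp add: algebra_simps)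
      finally show ?thesis using nz N by (simp add: nonzero_eq_divide_eq)
    qed
    have arg: "(of_int k * v + of_int \<mu>) / (of_int (int N * l) * v + of_int (int D)) =
        (- 1 / (of_nat N * z) + of_int \<mu>) / of_nat D"
      unfolding j num using nz N D by (simp add: field_simps)
    have det: "k * int D - \<mu> * (int N * l) = 1" using k by (simp add: algebra_simps)
    have "F ((- 1 / (of_nat N * z) + of_int \<mu>) / of_nat D) =
        psi (int D) * (of_nat D * z / y) powi r * (of_nat D * cnj z / cnj y) powi s * F v"
      using Gamma0_transform[OF F det dvd_triv_left v] unfolding arg unfolding j j' by (simp only: of_int_of_nat_eq)
    \<comment> \<open>The automorphy factors D z/y meet the factors sqrt(N) y/D of the slash
      operator. Their product sqrt(N) z no longer involves l, so \<open>K\<close> can leave the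
      sum.\<close>
    also have "\<dots> = K * G (y / of_nat D)"
    proof -
      have "- 1 / (of_nat N * (y / of_nat D)) = v" by (simp add: v_def)
      then have "G (y / of_nat D) = (of_real (sqrt N) * (y / of_nat D)) powi (- r) *
          (of_real (sqrt N) * (cnj y / of_nat D)) powi (- s) * F v"
        using N D nz by (simp add: G_def slash_fricke)
      then show ?thesis using N D nz
        by (simp add: K_def power_int_mult_distrib power_int_divide_distrib power_int_minus field_simps)
    qed
    finally show ?thesis by (simp add: y_def)
  qed
  have ex: "\<exists>l\<in>U. int D dvd int N * l * \<mu> + 1" if "\<mu> \<in> U" for \<mu>
  proof -
    have "coprime (int N * \<mu>) (int D)" using that copN by (simp add: U_def)
    then obtain b c where bc: "b * (int N * \<mu>) + c * int D = 1"
      using bezout_int[of "int N * \<mu>" "int D"] by (metis coprime_iff_gcd_eq_1)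
    \<comment> \<open>Here b inverts N \<mu> modulo D, so -b solves the congruence; reduction modulo
      D puts it in the range of summation.\<close>
    define l where "l = (- b) mod int D"
    have "int N * l * \<mu> + 1 = int D * (c - int N * \<mu> * ((- b) div int D))"
      using bc unfolding l_def minus_div_mult_eq_mod[symmetric] by (simp add: algebra_simps)
    then have dvd: "int D dvd int N * l * \<mu> + 1" by simp
    have "coprime l (int D)"
    proof (rule coprimeI)
      fix d assume "d dvd l" "d dvd int D"
      then have "d dvd int N * l * \<mu>" "d dvd int N * l * \<mu> + 1" using dvd by (auto intro: dvd_trans)
      then show "is_unit d" by (simp add: dvd_add_right_iff)
    qed
    then show ?thesis using dvd D by (intro bexI[of _ l]) (auto simp: U_def l_def)
  qed
  have uniq: "l = l'" if "l \<in> U" "l' \<in> U" "\<mu> \<in> U" "int D dvd int N * l * \<mu> + 1" "int D dvd int N * l' * \<mu> + 1" for l l' \<mu>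
  proof -
    have "int D dvd (int N * l * \<mu> + 1) - (int N * l' * \<mu> + 1)" using that by (intro dvd_diff)
    then have "int D dvd (int N * \<mu>) * (l - l')" by (simp add: algebra_simps)
    moreover have "coprime (int D) (int N * \<mu>)" using that copN by (simp add: U_def coprime_commute)
    ultimately have "int D dvd l - l'" by (simp add: coprime_dvd_mult_right_iff)
    then have "l mod int D = l' mod int D" by (simp add: mod_eq_dvd_iff)
    then show ?thesis using that by (simp add: U_def)
  qed
  define inv where "inv \<mu> = (SOME l. l \<in> U \<and> int D dvd int N * l * \<mu> + 1)" for \<mu>
  have inv: "inv \<mu> \<in> U" "int D dvd int N * inv \<mu> * \<mu> + 1" if "\<mu> \<in> U" for \<mu>
    using someI_ex[of "\<lambda>l. l \<in> U \<and> int D dvd int N * l * \<mu> + 1"] ex[OF that] unfolding inv_def by auto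
  \<comment> \<open>The congruence is symmetric in l and \<mu>, so uniqueness makes
    \<open>inv\<close> an involution of \<open>U\<close> and hence a reindexing of the sum.\<close>
  have inv_inv: "inv (inv \<mu>) = \<mu>" if "\<mu> \<in> U" for \<mu>
    using uniq[of "inv (inv \<mu>)" \<mu> "inv \<mu>"] inv[OF that] inv[of "inv \<mu>"] that by (simp add: mult_ac)
  \<comment> \<open>Both sides are inverse to chi(\<mu>): the left because |chi(\<mu>)| = 1, the
    right because -N inv(\<mu>) \<mu> is 1 modulo D.\<close>
  have chi_inv: "cnj (chi \<mu>) = chi (- int N) * chi (inv \<mu>)" if "\<mu> \<in> U" for \<mu>
  proof -
    have "int D dvd (- int N * inv \<mu>) * \<mu> - 1"
      using inv(2)[OF that] by (subst dvd_minus_iff[symmetric]) (simp add: algebra_simps)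
    then have "chi ((- int N * inv \<mu>) * \<mu>) = chi 1"
      by (intro dirichlet_character_cong[OF chi]) (simp add: mod_eq_dvd_iff)
    then have "chi (- int N) * chi (inv \<mu>) * chi \<mu> = 1" by (simp only: mult one)
    moreover have "cnj (chi \<mu>) * chi \<mu> = 1"
      using dirichlet_character_norm[OF chi D, of \<mu>] that
      by (simp add: U_def complex_norm_square[symmetric] mult.commute)
    ultimately show ?thesis by (metis mult_cancel_right zero_neq_one mult_zero_right)
  qed
  have "twist r s D chi F (- 1 / (of_nat N * z)) =
      (\<Sum>\<mu>\<in>U. cnj (chi \<mu>) * F ((- 1 / (of_nat N * z) + of_int \<mu>) / of_nat D))"
    unfolding twist_eq[OF D] U_def by (rule sum.mono_neutral_right) (auto simp: zero)
  also have "\<dots> = (\<Sum>\<mu>\<in>U. chi (- int N) * chi (inv \<mu>) * (K * G ((z + of_int (inv \<mu>)) / of_nat D)))"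
    by (intro sum.cong refl) (simp only: chi_inv transform[OF inv(2)])
  also have "\<dots> = (\<Sum>l\<in>U. chi (- int N) * chi l * (K * G ((z + of_int l) / of_nat D)))"
    by (rule sum.reindex_bij_witness[of _ inv inv]) (auto simp: inv inv_inv)
  also have "\<dots> = chi (- int N) * K * (\<Sum>l\<in>U. cnj (cnj_char chi l) * G ((z + of_int l) / of_nat D))"
    by (simp add: sum_distrib_left cnj_char_def mult_ac)
  also have "(\<Sum>l\<in>U. cnj (cnj_char chi l) * G ((z + of_int l) / of_nat D)) = twist r s D (cnj_char chi) G z"
    unfolding twist_eq[OF D] U_def by (rule sum.mono_neutral_left) (auto simp: zero cnj_char_def)
  finally show ?thesis by (simp add: K_def G_def mult_ac)
qed

section \<open>The functional equation\<close>

text \<open>Rewrites the powers of u^2 + 1 and N with half-integral exponents in the functional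
  equation as integer powers of their square roots.\<close>

lemma square_powr_half:
  fixes x :: real
  assumes "x > 0"
  shows "x\<^sup>2 powr (real_of_int k / 2) = x powi k"
proof -
  have "x\<^sup>2 powr (real_of_int k / 2) = (x powr 2) powr (real_of_int k / 2)"
    using assms by (simp add: powr_numeral)
  also have "\<dots> = x powi k"
    unfolding powr_powr using assms by (simp add: powr_real_of_int')
  finally show ?thesis .
qed

theorem theorem4p12:
  fixes r s :: int and N D :: nat
    and psi chi :: "int \<Rightarrow> complex"
    and F G :: "complex \<Rightarrow> complex"
    and A B :: expansion
  assumes "N > 0" and "D > 0" and "coprime D N"
    and "dirichlet_character N psi" and "dirichlet_character D chi"
    and "psi (- 1) = (- 1) powi (r + s)"
    and "F \<in> weak_forms r s N psi"
    and "has_expansion F 1 A" and "coeff_growth A"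
    and "G = slash r s F (fricke N)"
    and "has_expansion G 1 B" and "coeff_growth B"
  shows "test_space_pair r s N D A B \<noteq> {} \<and>
    (\<forall>\<phi>\<in>test_space_pair r s N D A B. \<forall>u::real.
       L_series D (twist_expansion D chi A) \<phi> u =
         ((\<i> - of_real u) powi r * (- \<i> - of_real u) powi s * chi (- int N) * psi (int D)) /
         of_real ((u\<^sup>2 + 1) powr (real_of_int (r + s) / 2) *
                  real N powr (real_of_int (r + s - 2) / 2)) *
         L_series D (twist_expansion D (cnj_char chi) B) (slash_pos (2 - r - s) N \<phi>) (- u))"
proof (intro conjI ballI allI)
  have zero: "(\<lambda>_. 0) \<in> test_space M A'" for M A'
    by (auto simp: test_space_def piecewise_continuous_pos_def laplace_abs_def mult_pow_def case_prod_unfold)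
  have "(\<lambda>_. 0) \<in> test_space_pair r s N D A B"
    using zero by (simp add: test_space_pair_def slash_pos_def[abs_def])
  then show "test_space_pair r s N D A B \<noteq> {}" by blast
next
  fix \<phi> and u :: real
  assume \<phi>: "\<phi> \<in> test_space_pair r s N D A B"
  define \<phi>' where "\<phi>' = slash_pos (2 - r - s) N \<phi>"
  define R where "R = sqrt (u\<^sup>2 + 1)"
  define H where "H = twist r s D chi F"
  define H' where "H' = twist r s D (cnj_char chi) G"
  define n where "n = sqrt (real N)"
  have R: "R > 0" "R\<^sup>2 = u\<^sup>2 + 1" unfolding R_def by (auto simp: add_nonneg_pos)
  have n: "n > 0" "real N = n\<^sup>2" using \<open>N > 0\<close> by (auto simp: n_def)
  \<comment> \<open>The points p t/R with t > 0 form the ray of parameter -u, and q is the conjugate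
    of p.\<close>
  define p where "p = \<i> - of_real u"
  define q where "q = - \<i> - of_real u"
  define K where "K = chi (- int N) * psi (int D) * p powi r * q powi s / of_real (R powi (r + s) * n powi (r + s - 2))"
  have \<phi>_test: "\<phi> \<in> test_space D (twist_expansion D chi A)" "\<phi>' \<in> test_space D (twist_expansion D (cnj_char chi) B)"
    using \<phi> \<open>dirichlet_character D chi\<close> by (auto simp: test_space_pair_def \<phi>'_def)
  have exp: "has_expansion H D (twist_expansion D chi A)" "has_expansion H' D (twist_expansion D (cnj_char chi) B)"
    unfolding H_def H'_def using assms by (auto intro: has_expansion_twist)
  note L = L_series_eq_integral[OF \<open>D > 0\<close> exp(1) \<phi>_test(1), of u, folded R_def]
  have L': "L_series D (twist_expansion D (cnj_char chi) B) \<phi>' (- u) = (LBINT t:{0<..}. \<phi>' t * H' (p * of_real (t / R))) / of_real R"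
    using L_series_eq_integral(2)[OF \<open>D > 0\<close> exp(2) \<phi>_test(2), of "- u"] by (simp add: R_def p_def)
  have pointwise: "\<phi> (1 / (N * t)) * H ((of_real u + \<i>) * of_real (1 / (N * t) / R)) / of_real (N * t\<^sup>2) =
      K * (\<phi>' t * H' (p * of_real (t / R)))" if "t > 0" for t :: real
  proof -
    define z where "z = p * of_real (t / R)"
    have z: "z \<in> upper_half_plane" using that R by (auto simp: z_def p_def upper_half_plane_def)
    have cnj_z: "cnj z = q * of_real (t / R)" by (simp add: z_def p_def q_def)
    \<comment> \<open>The automorphy factors contribute the exponent r + s of t and the Jacobian
      1/(N t^2) lowers it by 2. This explains the weight 2 - r - s of the action on \<phi>; the
      surplus power of sqrt(N) goes into \<open>K\<close>.\<close>
    have eq: "(n * t / R) powi (r + s) / (real N * t\<^sup>2) =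
        (real N * t) powi (- (2 - r - s)) / (R powi (r + s) * n powi (r + s - 2))"
    proof -
      have "n * n * (n * n) powi (r + s) = n powi (r + s) * (n powi (r + s) * (n * n))" 
        by (simp add: power_int_mult_distrib)
      moreover have "- (2 - r - s) = r + s - 2" by simp
      ultimately show ?thesis using R n that
        by (simp add: n(2) power_int_mult_distrib power_int_divide_distrib power_int_diff power2_eq_square field_simps)
    qed
    \<comment> \<open>This identity shows that z -> -1/(N z) carries the point with parameter t on
      the ray of -u to the point with parameter 1/(N t) on the ray of u.\<close>
    have "(of_real u + \<i>) * p = - of_real (R\<^sup>2)"
      unfolding R p_def by (simp add: algebra_simps power2_eq_square)
    moreover have "p \<noteq> 0" by (auto simp: p_def complex_eq_iff)
    ultimately have "of_real u + \<i> = - of_real (R\<^sup>2) / p" by (simp add: field_simps)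
    then have "(of_real u + \<i>) * of_real (1 / (N * t) / R) = - 1 / (of_nat N * z)"
      using R that \<open>N > 0\<close> by (simp add: z_def power2_eq_square)
    then have "\<phi> (1 / (N * t)) * H ((of_real u + \<i>) * of_real (1 / (N * t) / R)) / of_real (N * t\<^sup>2) =
        \<phi> (1 / (N * t)) * H (- 1 / (of_nat N * z)) / of_real (N * t\<^sup>2)" by (simp only:)
    also have "H (- 1 / (of_nat N * z)) = chi (- int N) * psi (int D) *
        (of_real n * z) powi r * (of_real n * cnj z) powi s * H' z"
      unfolding H_def H'_def n_def \<open>G = _\<close> using assms z
      by (intro twist_fricke) (auto simp: weak_forms_def)
    also have "\<dots> = chi (- int N) * psi (int D) * ((of_real n * z) powi r * (of_real n * cnj z) powi s) * H' z"
      by (simp only: mult.assoc)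
    also have "(of_real n * z) powi r * (of_real n * cnj z) powi s = p powi r * q powi s *
        of_real ((n * t / R) powi (r + s))"
      using R n that unfolding cnj_z unfolding z_def
      by (simp add: power_int_mult_distrib power_int_divide_distrib power_int_add mult_ac)
    also have "\<phi> (1 / (N * t)) * (chi (- int N) * psi (int D) * (p powi r * q powi s *
        of_real ((n * t / R) powi (r + s))) * H' z) / of_real (N * t\<^sup>2) =
        chi (- int N) * psi (int D) * p powi r * q powi s * of_real ((n * t / R) powi (r + s) / (N * t\<^sup>2)) *
        \<phi> (1 / (N * t)) * H' z"
      by simp
    also have "\<dots> = K * (\<phi>' t * H' z)"
      unfolding eq K_def by (simp add: \<phi>'_def slash_pos_def)
    finally show ?thesis unfolding z_def .
  qed
  \<comment> \<open>Inversion with c = N moves the integral to the ray of -u, where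
    \<open>pointwise\<close> makes the integrand a constant multiple of the one for G.\<close>
  have "(LBINT t:{0<..}. \<phi> t * H ((of_real u + \<i>) * of_real (t / R))) =
      (LBINT t:{0<..}. \<phi> (1 / (N * t)) * H ((of_real u + \<i>) * of_real (1 / (N * t) / R)) / of_real (N * t\<^sup>2))"
    using \<open>N > 0\<close> L(1) by (intro set_integral_inversion) auto
  also have "\<dots> = (LBINT t:{0<..}. K * (\<phi>' t * H' (p * of_real (t / R))))"
    by (intro set_lebesgue_integral_cong allI impI) (simp, rule pointwise, simp)
  also have "\<dots> = K * (LBINT t:{0<..}. \<phi>' t * H' (p * of_real (t / R)))"
    by simp
  finally have "L_series D (twist_expansion D chi A) \<phi> u = K * L_series D (twist_expansion D (cnj_char chi) B) \<phi>' (- u)"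
    unfolding L(2) L' by simp
  moreover have "(u\<^sup>2 + 1) powr (real_of_int (r + s) / 2) = R powi (r + s)"
    unfolding R(2)[symmetric] using R(1) by (rule square_powr_half)
  moreover have "real N powr (real_of_int (r + s - 2) / 2) = n powi (r + s - 2)"
    unfolding n(2) using n(1) by (rule square_powr_half)
  ultimately show "L_series D (twist_expansion D chi A) \<phi> u =
         ((\<i> - of_real u) powi r * (- \<i> - of_real u) powi s * chi (- int N) * psi (int D)) /
         of_real ((u\<^sup>2 + 1) powr (real_of_int (r + s) / 2) *
                  real N powr (real_of_int (r + s - 2) / 2)) *
         L_series D (twist_expansion D (cnj_char chi) B) (slash_pos (2 - r - s) N \<phi>) (- u)"
    unfolding K_def p_def q_def \<phi>'_def by (simp add: mult_ac)
qed

end
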